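(* Let $n\ge 3$ be an integer and $L=\binom n2$. Let $A$ be the triangle inequality constraint matrix on $n$ points, and let $H\in\mathbb{R}^{L\times L}$ be the matrix with entries $H_{\alpha,\beta}=\langle w_\alpha,w_\beta\rangle$, $\alpha,\beta\in\mathbb{I}$. Then $A^\top A$ and $-H$ are identical up to a multiple of the identity matrix, i.e. there is a scalar $c\in\mathbb{R}$ (depending only on $n$) such that $A^\top A=cI_L-H$.
   Context: Let $\mathbb{I}=\{(i,j):1\le i<j\le n\}$, of size $L=n(n-1)/2$. Let $e_{i,j}\in\mathbb{R}^{n\times n}$ be the matrix whose only nonzero entry is a $1$ at position $(i,j)$. For $\alpha=(\alpha_1,\alpha_2)\in\mathbb{I}$ define $w_\alpha=e_{\alpha_1,\alpha_1}+e_{\alpha_2,\alpha_2}-e_{\alpha_1,\alpha_2}-e_{\alpha_2,\alpha_1}$. $\langle X,Y\rangle=\operatorname{trace}(X^\top Y)$ is the trace inner product. The triangle inequality constraint matrix $A$ encodes the triangle inequalities $D_{i,k}-D_{i,j}-D_{j,k}\le 0$ for a symmetric array of distances $D$ among $n$ points: its columns are indexed by $\mathbb{I}$ (the column $(i,j)$ represents the distance $D_{i,j}=D_{j,i}$); its rows are indexed by the triangle inequalities, one for each choice of an unordered pair $\{i,k\}$ of distinct points and a third point $j\notin\{i,k\}$ (so there are three rows for each 3-element subset of points). The row of the inequality $D_{i,k}-D_{i,j}-D_{j,k}\le0$ has entry $+1$ in the column of the pair $\{i,k\}$, entry $-1$ in the columns of the pairs $\{i,j\}$ and $\{j,k\}$,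 and $0$ in all other columns. *)

theory Defs
  imports "Jordan_Normal_Form.Matrix"
begin

definition pairs :: "nat \<Rightarrow> (nat \<times> nat) set" where
  "pairs n = {(i, j). 1 \<le> i \<and> i < j \<and> j \<le> n}"

(* Points and matrix positions are numbered from 1 to n; Matrix.mat counts from 0, hence Suc. *)
definition unit_entry_mat :: "nat \<Rightarrow> nat \<Rightarrow> nat \<Rightarrow> real mat" where
  "unit_entry_mat n i j = mat n n (\<lambda>(r, s). if Suc r = i \<and> Suc s = j then 1 else 0)"

definition w_mat :: "nat \<Rightarrow> nat \<times> nat \<Rightarrow> real mat" where
  "w_mat n \<alpha> =
     unit_entry_mat n (fst \<alpha>) (fst \<alpha>) + unit_entry_mat n (snd \<alpha>) (snd \<alpha>)
     - unit_entry_mat n (fst \<alpha>) (snd \<alpha>) - unit_entry_mat n (snd \<alpha>) (fst \<alpha>)"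

definition mat_trace :: "real mat \<Rightarrow> real" where
  "mat_trace X = (\<Sum>i<dim_row X. X $$ (i, i))"

definition trace_inner :: "real mat \<Rightarrow> real mat \<Rightarrow> real" where
  "trace_inner X Y = mat_trace (transpose_mat X * Y)"

(* The element of pairs n that represents the unordered pair {i, j}. *)
definition sorted_pair :: "nat \<Rightarrow> nat \<Rightarrow> nat \<times> nat" where
  "sorted_pair i j = (min i j, max i j)"

(* ((i, k), j) stands for the inequality D i k - D i j - D j k \<le> 0. *)
definition triangle_ineqs :: "nat \<Rightarrow> ((nat \<times> nat) \<times> nat) set" where
  "triangle_ineqs n = {((i, k), j). (i, k) \<in> pairs n \<and> j \<in> {1..n} \<and> j \<noteq> i \<and> j \<noteq> k}"

definition triangle_entry :: "(nat \<times> nat) \<times> nat \<Rightarrow> nat \<times> nat \<Rightarrow> real" where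
  "triangle_entry = (\<lambda>((i, k), j) \<beta>.
     if \<beta> = sorted_pair i k then 1
     else if \<beta> = sorted_pair i j \<or> \<beta> = sorted_pair j k then - 1
     else 0)"

(* A matrix whose rows and columns are indexed by finite sets becomes an ordinary matrix
   once these sets are listed in some order. *)
definition enumerates :: "'a list \<Rightarrow> 'a set \<Rightarrow> bool" where
  "enumerates xs S \<longleftrightarrow> distinct xs \<and> set xs = S"

definition indexed_mat :: "'a list \<Rightarrow> 'b list \<Rightarrow> ('a \<Rightarrow> 'b \<Rightarrow> real) \<Rightarrow> real mat" where
  "indexed_mat rs cs f = mat (length rs) (length cs) (\<lambda>(p, q). f (rs ! p) (cs ! q))"

definition triangle_mat :: "((nat \<times> nat) \<times> nat) list \<Rightarrow> (nat \<times> nat) list \<Rightarrow> real mat" where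
  "triangle_mat rs cs = indexed_mat rs cs triangle_entry"

definition H_mat :: "nat \<Rightarrow> (nat \<times> nat) list \<Rightarrow> real mat" where
  "H_mat n cs = indexed_mat cs cs (\<lambda>\<alpha> \<beta>. trace_inner (w_mat n \<alpha>) (w_mat n \<beta>))"

lemma finite_pairs: "finite (pairs n)"
  by (rule finite_subset[of _ "{..n} \<times> {..n}"]) (auto simp: pairs_def)

lemma finite_triangle_ineqs: "finite (triangle_ineqs n)"
  by (rule finite_subset[of _ "pairs n \<times> {1..n}"])
    (auto simp: triangle_ineqs_def finite_pairs)

lemma ex_enumerates: "finite S \<Longrightarrow> \<exists>xs. enumerates xs S"
  using finite_distinct_list[of S] by (auto simp: enumerates_def)

end

theory Submission
  imports Defs
begin

text \<open>
  Both matrices reduce to the Gram matrix with entries \<open>\<bar>\<alpha> \<inter> \<beta>\<bar>\<close>, where the pairs \<open>\<alpha>\<close>, \<open>\<beta>\<close> are read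
  as edges of the complete graph on \<open>n\<close> points.

  The matrix \<open>w\<^sub>\<alpha>\<close> is the Laplacian of the single edge \<open>\<alpha>\<close>: the diagonal matrix of its vertex
  degrees minus its adjacency matrix. The two parts have disjoint supports, so
  \<open>\<langle>w\<^sub>\<alpha>, w\<^sub>\<beta>\<rangle> = \<bar>\<alpha> \<inter> \<beta>\<bar> + 2[\<alpha> = \<beta>]\<close> (\<open>trace_inner_w_mat\<close>).

  On the other side, twice the sum over all triangle inequalities is a sum over ordered triples
  \<open>(i, j, k)\<close> of distinct points. Write \<open>a\<close> for the adjacency function of \<open>\<alpha>\<close> and \<open>b\<close> for that of
  \<open>\<beta>\<close>. The summand is the product of \<open>a i k - a i j - a j k\<close> and \<open>b i k - b i j - b j k\<close>. Its three
  square terms such as \<open>a i k * b i k\<close> contribute \<open>2 (n - 2) [\<alpha> = \<beta>]\<close> each. Its six mixed terms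
  have two plus and four minus signs, and by relabelling the points each contributes the same number
  \<open>T\<close>, which counts the paths \<open>i - j - k\<close> with \<open>i \<noteq> k\<close> whose first edge is \<open>\<alpha>\<close> and whose second is
  \<open>\<beta>\<close>; so \<open>T = \<bar>\<alpha> \<inter> \<beta>\<bar> - 2[\<alpha> = \<beta>]\<close>. Hence an entry of the product of the transposed triangle matrix
  with itself is \<open>3 (n - 2) [\<alpha> = \<beta>] - T = (3 n - 4) [\<alpha> = \<beta>] - \<bar>\<alpha> \<inter> \<beta>\<bar>\<close>
  (\<open>sum_triangle_entry_mult\<close>), and \<open>c = 3 n - 2\<close> works.
\<close>

section \<open>Adjacency and degree functions of a single edge\<close>

definition edge_adj :: "nat \<times> nat \<Rightarrow> nat \<Rightarrow> nat \<Rightarrow> real" where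
  "edge_adj \<alpha> i j = of_bool (sorted_pair i j = \<alpha>)"

definition edge_deg :: "nat \<times> nat \<Rightarrow> nat \<Rightarrow> real" where
  "edge_deg \<alpha> i = of_bool (i = fst \<alpha> \<or> i = snd \<alpha>)"

definition common_points :: "nat \<Rightarrow> nat \<times> nat \<Rightarrow> nat \<times> nat \<Rightarrow> real" where
  "common_points n \<alpha> \<beta> = (\<Sum>i\<in>{1..n}. edge_deg \<alpha> i * edge_deg \<beta> i)"

lemma edge_adj_commute: "edge_adj \<alpha> i j = edge_adj \<alpha> j i"
  by (simp add: edge_adj_def sorted_pair_def min.commute max.commute)

lemma edge_adj_refl: "\<alpha> \<in> pairs n \<Longrightarrow> edge_adj \<alpha> i i = 0"
  by (auto simp: edge_adj_def sorted_pair_def pairs_def)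

lemma edge_adj_pair:
  "a < b \<Longrightarrow> edge_adj (a, b) i j = of_bool (i = a \<and> j = b) + of_bool (i = b \<and> j = a)"
  by (cases "i \<le> j") (auto simp: edge_adj_def sorted_pair_def)

lemma edge_deg_pair: "a < b \<Longrightarrow> edge_deg (a, b) i = of_bool (i = a) + of_bool (i = b)"
  by (auto simp: edge_deg_def)

lemma edge_adj_mult: "edge_adj \<alpha> i j * edge_adj \<beta> i j = of_bool (\<alpha> = \<beta>) * edge_adj \<alpha> i j"
  by (auto simp: edge_adj_def)

lemma sum_edge_adj:
  assumes "\<alpha> \<in> pairs n"
  shows "(\<Sum>j\<in>{1..n}. edge_adj \<alpha> i j) = edge_deg \<alpha> i"
proof -
  obtain a b where ab: "\<alpha> = (a, b)" "1 \<le> a" "a < b" "b \<le> n"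
    using assms by (auto simp: pairs_def)
  have "edge_adj \<alpha> i j = (if j = b then of_bool (i = a) else 0) + (if j = a then of_bool (i = b) else 0)"
    for j using ab by (simp add: edge_adj_pair)
  then show ?thesis
    using ab by (simp add: sum.distrib edge_deg_pair)
qed

lemma sum_edge_deg:
  assumes "\<alpha> \<in> pairs n"
  shows "(\<Sum>i\<in>{1..n}. edge_deg \<alpha> i) = 2"
proof -
  obtain a b where ab: "\<alpha> = (a, b)" "1 \<le> a" "a < b" "b \<le> n"
    using assms by (auto simp: pairs_def)
  have "edge_deg \<alpha> i = (if i = a then 1 else 0) + (if i = b then 1 else 0)" for i
    using ab by (simp add: edge_deg_pair)
  then show ?thesis
    using ab by (simp add: sum.distrib)
qed

lemma sum_edge_adj_mult:
  assumes "\<alpha> \<in> pairs n"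
  shows "(\<Sum>i\<in>{1..n}. \<Sum>j\<in>{1..n}. edge_adj \<alpha> i j * edge_adj \<beta> i j) = 2 * of_bool (\<alpha> = \<beta>)"
  by (simp only: edge_adj_mult sum_distrib_left[symmetric] sum_edge_adj[OF assms]
      sum_edge_deg[OF assms] mult.commute[of _ 2])

section \<open>The inner products of edge Laplacians\<close>

lemma w_mat_carrier: "w_mat n \<alpha> \<in> carrier_mat n n"
  by (rule carrier_matI) (simp_all add: w_mat_def unit_entry_mat_def)

lemma w_mat_entry:
  assumes "\<alpha> \<in> pairs n" "r < n" "s < n"
  shows "w_mat n \<alpha> $$ (r, s) = of_bool (r = s) * edge_deg \<alpha> (Suc r) - edge_adj \<alpha> (Suc r) (Suc s)"
proof -
  obtain a b where ab: "\<alpha> = (a, b)" "a < b"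
    using assms(1) by (auto simp: pairs_def)
  have "w_mat n \<alpha> $$ (r, s) = of_bool (Suc r = a \<and> Suc s = a) + of_bool (Suc r = b \<and> Suc s = b)
      - of_bool (Suc r = a \<and> Suc s = b) - of_bool (Suc r = b \<and> Suc s = a)"
    using assms(2,3) ab(1) by (simp add: w_mat_def unit_entry_mat_def of_bool_def)
  also have "\<dots> = of_bool (r = s) * edge_deg \<alpha> (Suc r) - edge_adj \<alpha> (Suc r) (Suc s)"
    unfolding ab(1) edge_adj_pair[OF ab(2)] edge_deg_pair[OF ab(2)]
    by (cases "r = s") auto
  finally show ?thesis .
qed

lemma trace_inner_entries:
  assumes "X \<in> carrier_mat n n" "Y \<in> carrier_mat n n"
  shows "trace_inner X Y = (\<Sum>s<n. \<Sum>r<n. X $$ (r, s) * Y $$ (r, s))"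
  using assms by (auto simp: trace_inner_def mat_trace_def scalar_prod_def atLeast0LessThan)

lemma trace_inner_w_mat:
  assumes "\<alpha> \<in> pairs n" "\<beta> \<in> pairs n"
  shows "trace_inner (w_mat n \<alpha>) (w_mat n \<beta>) = common_points n \<alpha> \<beta> + 2 * of_bool (\<alpha> = \<beta>)"
proof -
  have shift: "(\<Sum>r<n. f (Suc r)) = (\<Sum>r\<in>{1..n}. f r)" for f :: "nat \<Rightarrow> real"
    by (rule sum.reindex_bij_witness[of _ "\<lambda>r. r - 1" Suc]) auto
  have entry: "w_mat n \<alpha> $$ (r, s) * w_mat n \<beta> $$ (r, s)
      = (if r = s then edge_deg \<alpha> (Suc s) * edge_deg \<beta> (Suc s) else 0)
        + edge_adj \<alpha> (Suc s) (Suc r) * edge_adj \<beta> (Suc s) (Suc r)"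
    if "r < n" "s < n" for r s
    using that assms edge_adj_refl[OF assms(1)] edge_adj_refl[OF assms(2)]
    by (auto simp: w_mat_entry edge_adj_commute[of _ "Suc r"])
  have "trace_inner (w_mat n \<alpha>) (w_mat n \<beta>)
      = (\<Sum>s<n. \<Sum>r<n. (if r = s then edge_deg \<alpha> (Suc s) * edge_deg \<beta> (Suc s) else 0)
          + edge_adj \<alpha> (Suc s) (Suc r) * edge_adj \<beta> (Suc s) (Suc r))"
    unfolding trace_inner_entries[OF w_mat_carrier w_mat_carrier]
    by (intro sum.cong refl) (simp add: entry)
  also have "\<dots> = (\<Sum>s<n. edge_deg \<alpha> (Suc s) * edge_deg \<beta> (Suc s))
      + (\<Sum>s<n. \<Sum>r<n. edge_adj \<alpha> (Suc s) (Suc r) * edge_adj \<beta> (Suc s) (Suc r))"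
    by (simp add: sum.distrib)
  also have "\<dots> = common_points n \<alpha> \<beta> + 2 * of_bool (\<alpha> = \<beta>)"
    unfolding common_points_def sum_edge_adj_mult[OF assms(1), of \<beta>, symmetric]
    by (simp only: shift[of "\<lambda>r. edge_adj \<alpha> (Suc s) r * edge_adj \<beta> (Suc s) r" for s]
        shift[of "\<lambda>s. \<Sum>r\<in>{1..n}. edge_adj \<alpha> s r * edge_adj \<beta> s r"]
        shift[of "\<lambda>s. edge_deg \<alpha> s * edge_deg \<beta> s"])
  finally show ?thesis .
qed

section \<open>Sums over ordered triples of distinct points\<close>

definition triples :: "nat \<Rightarrow> (nat \<times> nat \<times> nat) set" where
  "triples n = {(i, j, k). i \<in> {1..n} \<and> j \<in> {1..n} \<and> k \<in> {1..n} \<and> i \<noteq> j \<and> j \<noteq> k \<and> i \<noteq> k}"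

definition triple_sum :: "nat \<Rightarrow> (nat \<Rightarrow> nat \<Rightarrow> nat \<Rightarrow> real) \<Rightarrow> real" where
  "triple_sum n F = (\<Sum>(i, j, k)\<in>triples n. F i j k)"

lemma finite_triples: "finite (triples n)"
  by (rule finite_subset[of _ "{1..n} \<times> {1..n} \<times> {1..n}"]) (auto simp: triples_def)

lemma triple_sum_iterated:
  "triple_sum n F = (\<Sum>i\<in>{1..n}. \<Sum>j\<in>{1..n}. \<Sum>k\<in>{1..n}.
     if i \<noteq> j \<and> j \<noteq> k \<and> i \<noteq> k then F i j k else 0)"
proof -
  have "triples n = {t \<in> {1..n} \<times> {1..n} \<times> {1..n}.
      case t of (i, j, k) \<Rightarrow> i \<noteq> j \<and> j \<noteq> k \<and> i \<noteq> k}"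
    by (auto simp: triples_def)
  then have "triple_sum n F = (\<Sum>(i, j, k)\<in>{1..n} \<times> {1..n} \<times> {1..n}.
      if i \<noteq> j \<and> j \<noteq> k \<and> i \<noteq> k then F i j k else 0)"
    unfolding triple_sum_def
    by (auto simp: sum.inter_filter intro!: sum.cong)
  then show ?thesis
    by (simp add: sum.cartesian_product)
qed

lemma triple_sum_swap_outer: "triple_sum n (\<lambda>i j k. F k j i) = triple_sum n F"
  unfolding triple_sum_def
  by (rule sum.reindex_bij_witness[of _ "\<lambda>(i, j, k). (k, j, i)" "\<lambda>(i, j, k). (k, j, i)"])
    (auto simp: triples_def)

lemma triple_sum_swap_left: "triple_sum n (\<lambda>i j k. F j i k) = triple_sum n F"
  unfolding triple_sum_def
  by (rule sum.reindex_bij_witness[of _ "\<lambda>(i, j, k). (j, i, k)" "\<lambda>(i, j, k). (j, i, k)"])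
    (auto simp: triples_def)

lemma triple_sum_swap_right: "triple_sum n (\<lambda>i j k. F i k j) = triple_sum n F"
  unfolding triple_sum_def
  by (rule sum.reindex_bij_witness[of _ "\<lambda>(i, j, k). (i, k, j)" "\<lambda>(i, j, k). (i, k, j)"])
    (auto simp: triples_def)

text \<open>
  A triangle inequality is an ordered triple up to exchanging the two ends of its long side, and the
  representative with \<open>i < k\<close> is the one listed.
\<close>

lemma sum_triangle_ineqs:
  assumes sym: "\<And>i j k. F i j k = F k j i"
  shows "2 * (\<Sum>((i, k), j)\<in>triangle_ineqs n. F i j k) = triple_sum n F"
proof -
  let ?up = "{(i, j, k) \<in> triples n. i < k}" and ?down = "{(i, j, k) \<in> triples n. k < i}"
  have up: "(\<Sum>((i, k), j)\<in>triangle_ineqs n. F i j k) = (\<Sum>(i, j, k)\<in>?up. F i j k)"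
    by (rule sum.reindex_bij_witness[of _ "\<lambda>(i, j, k). ((i, k), j)" "\<lambda>((i, k), j). (i, j, k)"])
      (auto simp: triangle_ineqs_def triples_def pairs_def)
  have down: "(\<Sum>((i, k), j)\<in>triangle_ineqs n. F i j k) = (\<Sum>(i, j, k)\<in>?down. F i j k)"
    by (rule sum.reindex_bij_witness[of _ "\<lambda>(i, j, k). ((k, i), j)" "\<lambda>((i, k), j). (k, j, i)"])
      (auto simp: triangle_ineqs_def triples_def pairs_def sym)
  have "triples n = ?up \<union> ?down"
    by (auto simp: triples_def)
  then have "triple_sum n F = (\<Sum>(i, j, k)\<in>?up \<union> ?down. F i j k)"
    unfolding triple_sum_def by (rule arg_cong)
  also have "\<dots> = (\<Sum>(i, j, k)\<in>?up. F i j k) + (\<Sum>(i, j, k)\<in>?down. F i j k)"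
    by (rule sum.union_disjoint) (auto intro: finite_subset[OF _ finite_triples])
  finally show ?thesis
    using up down by simp
qed

section \<open>The Gram matrix of the triangle inequalities\<close>

lemma sorted_pair_eq_iff:
  "sorted_pair i j = sorted_pair k l \<longleftrightarrow> i = k \<and> j = l \<or> i = l \<and> j = k"
  by (cases "i \<le> j"; cases "k \<le> l") (auto simp: sorted_pair_def)

lemma triangle_entry_eq_adj:
  assumes "((i, k), j) \<in> triangle_ineqs n"
  shows "triangle_entry ((i, k), j) \<alpha> = edge_adj \<alpha> i k - edge_adj \<alpha> i j - edge_adj \<alpha> j k"
proof -
  have "i \<noteq> k" "j \<noteq> i" "j \<noteq> k"
    using assms by (auto simp: triangle_ineqs_def pairs_def)
  then have "sorted_pair i k \<noteq> sorted_pair i j" "sorted_pair i k \<noteq> sorted_pair j k"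
      "sorted_pair i j \<noteq> sorted_pair j k"
    by (auto simp: sorted_pair_eq_iff)
  then show ?thesis
    by (auto simp: triangle_entry_def edge_adj_def)
qed

text \<open>For each of the two orientations of an edge, any of the other \<open>n - 2\<close> points can be the middle one.\<close>

lemma triple_sum_same_edge:
  assumes "\<alpha> \<in> pairs n"
  shows "triple_sum n (\<lambda>i j k. edge_adj \<alpha> i j * edge_adj \<beta> i j)
           = 2 * (real n - 2) * of_bool (\<alpha> = \<beta>)"
proof -
  have inner: "(\<Sum>k\<in>{1..n}. if i \<noteq> j \<and> j \<noteq> k \<and> i \<noteq> k
        then edge_adj \<alpha> i j * edge_adj \<beta> i j else 0)
      = (real n - 2) * (edge_adj \<alpha> i j * edge_adj \<beta> i j)"
    if "i \<in> {1..n}" "j \<in> {1..n}" for i j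
  proof (cases "i = j")
    case True
    then show ?thesis
      by (simp add: edge_adj_refl[OF assms])
  next
    case False
    define x where "x = edge_adj \<alpha> i j * edge_adj \<beta> i j"
    have split: "(if i \<noteq> j \<and> j \<noteq> k \<and> i \<noteq> k then x else 0)
        = x - (if k = i then x else 0) - (if k = j then x else 0)" for k
      using False by auto
    then show ?thesis
      using that unfolding x_def[symmetric] split by (simp add: sum_subtractf left_diff_distrib)
  qed
  have "triple_sum n (\<lambda>i j k. edge_adj \<alpha> i j * edge_adj \<beta> i j)
      = (real n - 2) * (\<Sum>i\<in>{1..n}. \<Sum>j\<in>{1..n}. edge_adj \<alpha> i j * edge_adj \<beta> i j)"
    unfolding triple_sum_iterated sum_distrib_left by (intro sum.cong refl inner)
  then show ?thesis
    by (simp only: sum_edge_adj_mult[OF assms] mult.assoc mult.left_commute)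
qed

text \<open>
  Among all walks \<open>i - j - k\<close> with first edge \<open>\<alpha>\<close> and second edge \<open>\<beta>\<close>, one for each common point \<open>j\<close>,
  the condition \<open>i \<noteq> k\<close> discards those that go back along the same edge.
\<close>

lemma triple_sum_path:
  assumes "\<alpha> \<in> pairs n" "\<beta> \<in> pairs n"
  shows "triple_sum n (\<lambda>i j k. edge_adj \<alpha> i j * edge_adj \<beta> j k)
           = common_points n \<alpha> \<beta> - 2 * of_bool (\<alpha> = \<beta>)"
proof -
  have walk: "(if j \<noteq> i \<and> i \<noteq> k \<and> j \<noteq> k then edge_adj \<alpha> j i * edge_adj \<beta> i k else 0)
      = edge_adj \<alpha> i j * edge_adj \<beta> i k
        - (if k = j then edge_adj \<alpha> i j * edge_adj \<beta> i j else 0)" for i j k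
    using edge_adj_refl[OF assms(1)] edge_adj_refl[OF assms(2)] edge_adj_commute[of \<alpha> j i]
    by auto
  \<comment> \<open>The middle point becomes the outermost summation variable.\<close>
  have "triple_sum n (\<lambda>i j k. edge_adj \<alpha> i j * edge_adj \<beta> j k)
      = triple_sum n (\<lambda>i j k. edge_adj \<alpha> j i * edge_adj \<beta> i k)"
    by (rule triple_sum_swap_left[symmetric])
  also have "\<dots> = (\<Sum>i\<in>{1..n}. \<Sum>j\<in>{1..n}. \<Sum>k\<in>{1..n}.
      if j \<noteq> i \<and> i \<noteq> k \<and> j \<noteq> k then edge_adj \<alpha> j i * edge_adj \<beta> i k else 0)"
    unfolding triple_sum_iterated by (intro sum.cong refl) auto
  also have "\<dots> = (\<Sum>i\<in>{1..n}. \<Sum>j\<in>{1..n}. \<Sum>k\<in>{1..n}. edge_adj \<alpha> i j * edge_adj \<beta> i k)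
      - (\<Sum>i\<in>{1..n}. \<Sum>j\<in>{1..n}. edge_adj \<alpha> i j * edge_adj \<beta> i j)"
    unfolding walk by (simp add: sum_subtractf)
  also have "(\<Sum>i\<in>{1..n}. \<Sum>j\<in>{1..n}. \<Sum>k\<in>{1..n}. edge_adj \<alpha> i j * edge_adj \<beta> i k)
      = common_points n \<alpha> \<beta>"
    unfolding common_points_def
    by (simp only: sum_product[symmetric] sum_edge_adj[OF assms(1)] sum_edge_adj[OF assms(2)])
  finally show ?thesis
    by (simp only: sum_edge_adj_mult[OF assms(1)])
qed

lemma triple_sum_add:
  "triple_sum n (\<lambda>i j k. F i j k + G i j k) = triple_sum n F + triple_sum n G"
  by (simp add: triple_sum_def sum.distrib case_prod_unfold)

lemma triple_sum_diff:
  "triple_sum n (\<lambda>i j k. F i j k - G i j k) = triple_sum n F - triple_sum n G"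
  by (simp add: triple_sum_def sum_subtractf case_prod_unfold)

lemma sum_triangle_entry_mult:
  assumes "\<alpha> \<in> pairs n" "\<beta> \<in> pairs n"
  shows "(\<Sum>r\<in>triangle_ineqs n. triangle_entry r \<alpha> * triangle_entry r \<beta>)
           = (3 * real n - 4) * of_bool (\<alpha> = \<beta>) - common_points n \<alpha> \<beta>"
proof -
  let ?a = "edge_adj \<alpha>" and ?b = "edge_adj \<beta>"
  let ?S = "triple_sum n (\<lambda>i j k. ?a i j * ?b i j)"
  let ?T = "triple_sum n (\<lambda>i j k. ?a i j * ?b j k)"
  have S2: "triple_sum n (\<lambda>i j k. ?a i k * ?b i k) = ?S"
    by (rule triple_sum_swap_right)
  have S3: "triple_sum n (\<lambda>i j k. ?a j k * ?b j k) = ?S"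
    using triple_sum_swap_outer[of n "\<lambda>i j k. ?a i j * ?b i j"]
    by (simp add: edge_adj_commute)
  have T_ij_ik: "triple_sum n (\<lambda>i j k. ?a i j * ?b i k) = ?T"
    using triple_sum_swap_left[of n "\<lambda>i j k. ?a i j * ?b j k"]
    by (simp add: edge_adj_commute)
  have T_ik_ij: "triple_sum n (\<lambda>i j k. ?a i k * ?b i j) = ?T"
    using triple_sum_swap_right[of n "\<lambda>i j k. ?a i j * ?b i k"] T_ij_ik by simp
  have T_jk_ij: "triple_sum n (\<lambda>i j k. ?a j k * ?b i j) = ?T"
    using triple_sum_swap_outer[of n "\<lambda>i j k. ?a i j * ?b j k"]
    by (simp add: edge_adj_commute)
  have T_ik_jk: "triple_sum n (\<lambda>i j k. ?a i k * ?b j k) = ?T"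
    using triple_sum_swap_right[of n "\<lambda>i j k. ?a i j * ?b j k"]
    by (simp add: edge_adj_commute)
  have T_jk_ik: "triple_sum n (\<lambda>i j k. ?a j k * ?b i k) = ?T"
    using triple_sum_swap_left[of n "\<lambda>i j k. ?a i k * ?b j k"] T_ik_jk by simp
  have "2 * (\<Sum>r\<in>triangle_ineqs n. triangle_entry r \<alpha> * triangle_entry r \<beta>)
      = 2 * (\<Sum>((i, k), j)\<in>triangle_ineqs n.
          (?a i k - ?a i j - ?a j k) * (?b i k - ?b i j - ?b j k))"
    by (intro arg_cong[of _ _ "(*) 2"] sum.cong) (auto simp: triangle_entry_eq_adj)
  also have "\<dots> = triple_sum n (\<lambda>i j k. (?a i k - ?a i j - ?a j k) * (?b i k - ?b i j - ?b j k))"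
    by (rule sum_triangle_ineqs) (simp add: edge_adj_commute algebra_simps)
  also have "\<dots> = triple_sum n (\<lambda>i j k.
      ?a i k * ?b i k + ?a i j * ?b i j + ?a j k * ?b j k
      + ?a i j * ?b j k + ?a j k * ?b i j
      - ?a i k * ?b i j - ?a i j * ?b i k - ?a i k * ?b j k - ?a j k * ?b i k)"
    by (simp add: algebra_simps)
  also have "\<dots> = 3 * ?S - 2 * ?T"
    by (simp only: triple_sum_add triple_sum_diff S2 S3 T_ij_ik T_ik_ij T_jk_ij T_ik_jk T_jk_ik)
  also have "\<dots> = 2 * ((3 * real n - 4) * of_bool (\<alpha> = \<beta>) - common_points n \<alpha> \<beta>)"
    unfolding triple_sum_same_edge[OF assms(1)] triple_sum_path[OF assms]
    by (simp add: algebra_simps)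
  finally show ?thesis
    by simp
qed

lemma card_pairs: "card (pairs n) = n choose 2"
proof -
  have "bij_betw (\<lambda>(i, j). {i, j}) (pairs n) {B. B \<subseteq> {1..n} \<and> card B = 2}"
  proof (rule bij_betwI')
    show "((case \<alpha> of (i, j) \<Rightarrow> {i, j}) = (case \<beta> of (i, j) \<Rightarrow> {i, j})) = (\<alpha> = \<beta>)"
      if "\<alpha> \<in> pairs n" "\<beta> \<in> pairs n" for \<alpha> \<beta>
      using that by (cases \<alpha>; cases \<beta>) (simp add: pairs_def doubleton_eq_iff, linarith)
    show "(case \<alpha> of (i, j) \<Rightarrow> {i, j}) \<in> {B. B \<subseteq> {1..n} \<and> card B = 2}" if "\<alpha> \<in> pairs n" for \<alpha>
      using that by (cases \<alpha>) (simp add: pairs_def)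
  next
    fix B assume "B \<in> {B. B \<subseteq> {1..n} \<and> card B = 2}"
    then obtain x y where "B = {x, y}" "x \<noteq> y" "{x, y} \<subseteq> {1..n}"
      by (auto simp: card_2_iff)
    then have "(min x y, max x y) \<in> pairs n" "B = {min x y, max x y}"
      by (auto simp: pairs_def min_def max_def)
    then show "\<exists>\<alpha>\<in>pairs n. B = (case \<alpha> of (i, j) \<Rightarrow> {i, j})"
      by force
  qed
  from bij_betw_same_card[OF this] show ?thesis
    by (simp only: n_subsets[OF finite_atLeastAtMost] card_atLeastAtMost diff_Suc_1)
qed

lemma gram_indexed_mat_entry:
  assumes "distinct rs" "p < length cs" "q < length cs"
  shows "(transpose_mat (indexed_mat rs cs f) * indexed_mat rs cs f) $$ (p, q)
           = (\<Sum>r\<in>set rs. f r (cs ! p) * f r (cs ! q))"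
proof -
  have "(\<Sum>r\<in>set rs. f r (cs ! p) * f r (cs ! q))
      = (\<Sum>m<length rs. f (rs ! m) (cs ! p) * f (rs ! m) (cs ! q))"
    by (rule sum.reindex_bij_betw[symmetric]) (rule bij_betw_nth[OF assms(1) refl refl])
  then show ?thesis
    using assms by (simp add: indexed_mat_def scalar_prod_def atLeast0LessThan)
qed

theorem claim7:
  fixes n :: nat
  assumes "n \<ge> 3"
  shows "\<exists>c::real. \<forall>rs cs.
           enumerates rs (triangle_ineqs n) \<and> enumerates cs (pairs n) \<longrightarrow>
           transpose_mat (triangle_mat rs cs) * triangle_mat rs cs
             = c \<cdot>\<^sub>m 1\<^sub>m (n choose 2) - H_mat n cs"
proof (intro exI allI impI)
  fix rs cs
  assume "enumerates rs (triangle_ineqs n) \<and> enumerates cs (pairs n)"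
  then have rs: "distinct rs" "set rs = triangle_ineqs n"
    and cs: "distinct cs" "set cs = pairs n"
    by (auto simp: enumerates_def)
  have len: "length cs = n choose 2"
    using distinct_card[OF cs(1)] cs(2) card_pairs by simp
  show "transpose_mat (triangle_mat rs cs) * triangle_mat rs cs
      = (3 * real n - 2) \<cdot>\<^sub>m 1\<^sub>m (n choose 2) - H_mat n cs" (is "?G = ?R")
  proof (rule eq_matI)
    fix p q assume "p < dim_row ?R" "q < dim_col ?R"
    then have pq: "p < length cs" "q < length cs"
      by (auto simp: H_mat_def indexed_mat_def)
    then have mem: "cs ! p \<in> pairs n" "cs ! q \<in> pairs n"
      using cs(2) nth_mem by blast+
    have eq: "cs ! p = cs ! q \<longleftrightarrow> p = q"
      using pq cs(1) by (simp add: nth_eq_iff_index_eq)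
    have "?G $$ (p, q)
        = (3 * real n - 4) * of_bool (cs ! p = cs ! q) - common_points n (cs ! p) (cs ! q)"
      using gram_indexed_mat_entry[OF rs(1) pq, of triangle_entry] rs(2)
        sum_triangle_entry_mult[OF mem] by (simp add: triangle_mat_def)
    also have "\<dots> = ?R $$ (p, q)"
      using pq eq by (simp add: len[symmetric] H_mat_def indexed_mat_def trace_inner_w_mat[OF mem])
    finally show "?G $$ (p, q) = ?R $$ (p, q)" .
  qed (auto simp: triangle_mat_def H_mat_def indexed_mat_def len)
qed

end
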